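(* Let $1\le p<\infty$, let $\{\beta(n)\}_{n\ge 0}$ be a sequence of positive numbers with $\beta(0)=1$, and let $m,n\in\mathbb{N}_0$. If $\varphi(z)=z^{m}$, then $C_{\varphi}\in B(\ell^{p}(\beta))$ if and only if $$\sup_{n\in\mathbb{N}_0}\frac{\beta(nm)}{\beta(n)}<\infty .$$ In this case $$\|C_{\varphi}\|=\sup_{n\in\mathbb{N}_0}\frac{\beta(nm)}{\beta(n)} .$$
   Context: $\mathbb{N}_0=\{0,1,2,\dots\}$. $\ell^{p}(\beta)$ is the space of formal power series $f(z)=\sum_{n\ge 0}\hat f(n)z^{n}$ (whether or not the series converges for any complex $z$) such that $\|f\|_\beta^p=\sum_{n\ge 0}|\hat f(n)|^p\beta(n)^p<\infty$, with norm $\|\cdot\|_\beta$. $C_\varphi$ is the composition operator $C_\varphi f=f\circ\varphi$; for $\varphi(z)=z^m$, $(f\circ\varphi)(z)=\sum_{n\ge0}\hat f(n)z^{nm}$. $B(\ell^p(\beta))$ denotes the bounded linear operators from $\ell^p(\beta)$ into itself, and $\|C_\varphi\|$ is the operator norm.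
   Formalization: The case m = 0 with p > 1 is excluded, since the claim fails there: for β ≡ 1 the supremum is 1, but f = Σ z^n/(n+1) lies in ℓ^p and C_φ f = Σ 1/(n+1) diverges; m = 0 with p = 1 is kept. *)

theory Defs
  imports Complex_Main "HOL-Computational_Algebra.Formal_Power_Series"
begin

definition lp_space :: "real \<Rightarrow> (nat \<Rightarrow> real) \<Rightarrow> complex fps set" where
  "lp_space p \<beta> = {f. summable (\<lambda>n. cmod (fps_nth f n) powr p * \<beta> n powr p)}"

definition lp_norm :: "real \<Rightarrow> (nat \<Rightarrow> real) \<Rightarrow> complex fps \<Rightarrow> real" where
  "lp_norm p \<beta> f = (\<Sum>n. cmod (fps_nth f n) powr p * \<beta> n powr p) powr (1 / p)"

text \<open>
  The library composition \<open>f oo \<phi>\<close> is only meaningful when \<open>\<phi>\<close> has zero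
  constant term (it truncates \<open>f\<close>, e.g. \<open>f oo 1\<close> has constant term \<open>fps_nth f 0\<close>
  instead of the sum of all coefficients of \<open>f\<close>).  Here the coefficients of
  \<open>f \<circ> \<phi> = (\<Sum>n. f\<^sub>n \<phi>^n)\<close> are the sums of convergent series, so that
  \<open>\<phi> = 1\<close> is covered too.  When \<open>\<phi>\<close> has zero constant term these series are
  finite sums, and the two notions agree (\<open>comp_op_eq_fps_compose\<close>).
\<close>

definition composable :: "complex fps \<Rightarrow> complex fps \<Rightarrow> bool" where
  "composable f \<phi> \<longleftrightarrow> (\<forall>k. summable (\<lambda>n. fps_nth f n * fps_nth (\<phi> ^ n) k))"

definition comp_op :: "complex fps \<Rightarrow> complex fps \<Rightarrow> complex fps" where
  "comp_op \<phi> f = Abs_fps (\<lambda>k. \<Sum>n. fps_nth f n * fps_nth (\<phi> ^ n) k)"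

definition bounded_linear_op ::
  "real \<Rightarrow> (nat \<Rightarrow> real) \<Rightarrow> (complex fps \<Rightarrow> complex fps) \<Rightarrow> bool" where
  "bounded_linear_op p \<beta> T \<longleftrightarrow>
     (\<forall>f\<in>lp_space p \<beta>. T f \<in> lp_space p \<beta>) \<and>
     (\<forall>f\<in>lp_space p \<beta>. \<forall>g\<in>lp_space p \<beta>. T (f + g) = T f + T g) \<and>
     (\<forall>f\<in>lp_space p \<beta>. \<forall>c. T (fps_const c * f) = fps_const c * T f) \<and>
     (\<exists>K. \<forall>f\<in>lp_space p \<beta>. lp_norm p \<beta> (T f) \<le> K * lp_norm p \<beta> f)"

text \<open>Only meaningful for \<open>T\<close> satisfying \<open>bounded_linear_op p \<beta> T\<close>:
  otherwise the real supremum may be over an unbounded set.\<close>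

definition op_norm ::
  "real \<Rightarrow> (nat \<Rightarrow> real) \<Rightarrow> (complex fps \<Rightarrow> complex fps) \<Rightarrow> real" where
  "op_norm p \<beta> T = (SUP f\<in>{f \<in> lp_space p \<beta>. lp_norm p \<beta> f \<le> 1}. lp_norm p \<beta> (T f))"

definition comp_op_bounded :: "real \<Rightarrow> (nat \<Rightarrow> real) \<Rightarrow> complex fps \<Rightarrow> bool" where
  "comp_op_bounded p \<beta> \<phi> \<longleftrightarrow>
     (\<forall>f\<in>lp_space p \<beta>. composable f \<phi>) \<and> bounded_linear_op p \<beta> (comp_op \<phi>)"

lemma
  assumes "fps_nth \<phi> 0 = 0"
  shows composable_if_nth_0: "composable f \<phi>"
    and comp_op_eq_fps_compose: "comp_op \<phi> f = f oo \<phi>"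
proof -
  have zero: "fps_nth f n * fps_nth (\<phi> ^ n) k = 0" if "n \<notin> {0..k}" for n k
    using startsby_zero_power_prefix[OF assms] that by simp
  show "composable f \<phi>"
    unfolding composable_def
    by (intro allI summable_finite[OF finite_atLeastAtMost]) (rule zero)
  have "(\<Sum>n. fps_nth f n * fps_nth (\<phi> ^ n) k)
      = (\<Sum>n=0..k. fps_nth f n * fps_nth (\<phi> ^ n) k)" for k
    by (rule suminf_finite[OF finite_atLeastAtMost]) (rule zero)
  then show "comp_op \<phi> f = f oo \<phi>"
    by (simp add: comp_op_def fps_eq_iff fps_compose_nth)
qed

end

theory Submission
  imports Defs
begin

text \<open>
  On monomials, composition with \<open>z\<^sup>m\<close> sends \<open>z\<^sup>n\<close>, of norm \<open>\<beta>(n)\<close>, to \<open>z\<^sup>n\<^sup>m\<close>, of norm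
  \<open>\<beta>(nm)\<close>.  Hence every bound \<open>K\<close> for the operator bounds all the ratios \<open>\<beta>(nm) / \<beta>(n)\<close>,
  and the operator norm is at least their supremum
  (\<open>lp_norm_monomial\<close>, \<open>comp_op_monomial\<close>).

  For the converse it suffices that \<open>\<beta>(nm) \<le> S \<beta>(n)\<close> for all \<open>n\<close> implies
  \<open>\<parallel>f \<circ> z\<^sup>m\<parallel> \<le> S \<parallel>f\<parallel>\<close> (\<open>comp_op_power_bound\<close>).  If \<open>m > 0\<close>, the monomials \<open>z\<^sup>n\<^sup>m\<close> are
  distinct, so the coefficients of \<open>f \<circ> z\<^sup>m\<close> are those of \<open>f\<close>, moved apart, and the
  series defining the two norms can be compared term by term.  If \<open>m = 0\<close>, all monomials
  collapse to the constant \<open>1\<close>, and \<open>f \<circ> 1\<close> is the sum of the coefficients of \<open>f\<close>; for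
  \<open>p = 1\<close> the triangle inequality gives the same estimate.

  In particular the supremum \<open>S\<close> of the ratios is itself an admissible bound, which makes
  the operator norm equal to \<open>S\<close>.
\<close>

section \<open>Weighted norms of formal power series\<close>

lemma lp_norm_mono_sums:
  assumes p: "1 \<le> p" and K: "0 \<le> K"
    and g: "(\<lambda>n. cmod (fps_nth g n) powr p * \<beta> n powr p) sums A"
    and f: "(\<lambda>n. cmod (fps_nth f n) powr p * \<beta> n powr p) sums B"
    and le: "A \<le> K powr p * B"
  shows "lp_norm p \<beta> g \<le> K * lp_norm p \<beta> f"
proof -
  have A: "0 \<le> A" by (rule sums_le[OF _ sums_zero g]) simp
  have B: "0 \<le> B" by (rule sums_le[OF _ sums_zero f]) simp
  have "lp_norm p \<beta> g = A powr (1 / p)"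
    using sums_unique[OF g] by (simp add: lp_norm_def)
  also have "\<dots> \<le> (K powr p * B) powr (1 / p)"
    using A le p by (intro powr_mono2) auto
  also have "\<dots> = K * B powr (1 / p)"
    using K B p by (simp add: powr_mult powr_powr)
  also have "\<dots> = K * lp_norm p \<beta> f"
    using sums_unique[OF f] by (simp add: lp_norm_def)
  finally show ?thesis .
qed

lemma lp_norm_monomial:
  assumes "1 \<le> p" and "0 < \<beta> n"
  shows "fps_const c * fps_X ^ n \<in> lp_space p \<beta>"
    and "lp_norm p \<beta> (fps_const c * fps_X ^ n) = cmod c * \<beta> n"
proof -
  have "(\<lambda>i. cmod (fps_nth (fps_const c * fps_X ^ n) i) powr p * \<beta> i powr p)
      = (\<lambda>i. if i = n then cmod c powr p * \<beta> i powr p else 0)"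
    by (auto simp: fun_eq_iff fps_X_power_nth)
  then have s: "(\<lambda>i. cmod (fps_nth (fps_const c * fps_X ^ n) i) powr p * \<beta> i powr p)
      sums (cmod c powr p * \<beta> n powr p)"
    using sums_single[of n "\<lambda>i. cmod c powr p * \<beta> i powr p"] by simp
  show "fps_const c * fps_X ^ n \<in> lp_space p \<beta>"
    using s by (simp add: lp_space_def sums_iff)
  show "lp_norm p \<beta> (fps_const c * fps_X ^ n) = cmod c * \<beta> n"
    unfolding lp_norm_def sums_unique[OF s, symmetric]
    using assms by (simp add: powr_mult powr_powr)
qed

section \<open>Composition operators\<close>

lemma comp_op_add:
  assumes "composable f \<phi>" and "composable g \<phi>"
  shows "comp_op \<phi> (f + g) = comp_op \<phi> f + comp_op \<phi> g"
  using assms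
  by (simp add: comp_op_def composable_def fps_eq_iff distrib_right suminf_add)

lemma comp_op_scale:
  assumes "composable f \<phi>"
  shows "comp_op \<phi> (fps_const c * f) = fps_const c * comp_op \<phi> f"
  using assms
  by (simp add: comp_op_def composable_def fps_eq_iff mult.assoc suminf_mult)

lemma comp_op_boundedI:
  assumes "\<And>f. f \<in> lp_space p \<beta> \<Longrightarrow> composable f \<phi>"
    and "\<And>f. f \<in> lp_space p \<beta> \<Longrightarrow> comp_op \<phi> f \<in> lp_space p \<beta>"
    and "\<And>f. f \<in> lp_space p \<beta> \<Longrightarrow> lp_norm p \<beta> (comp_op \<phi> f) \<le> K * lp_norm p \<beta> f"
  shows "comp_op_bounded p \<beta> \<phi>"
  unfolding comp_op_bounded_def bounded_linear_op_def
  using assms comp_op_add comp_op_scale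
  by (intro conjI ballI allI exI[of _ K]) simp_all

lemma nth_fps_X_power_power:
  "fps_nth (((fps_X :: complex fps) ^ m) ^ n) k = (if k = n * m then 1 else 0)"
  by (simp add: power_mult[symmetric] fps_X_power_nth mult.commute)

lemma comp_op_monomial:
  "comp_op (fps_X ^ m) (fps_const c * fps_X ^ n) = fps_const c * fps_X ^ (n * m)"
proof (rule fps_ext)
  fix k
  have "(\<lambda>i. fps_nth (fps_const c * fps_X ^ n) i * fps_nth ((fps_X ^ m) ^ i) k)
      = (\<lambda>i. if i = n then (if k = i * m then c else 0) else 0)"
    by (auto simp: fun_eq_iff fps_X_power_nth nth_fps_X_power_power)
  then show "fps_nth (comp_op (fps_X ^ m) (fps_const c * fps_X ^ n)) k
      = fps_nth (fps_const c * fps_X ^ (n * m)) k"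
    using sums_unique[OF sums_single[of n "\<lambda>i. if k = i * m then c else 0"], symmetric]
    by (simp only: comp_op_def fps_nth_Abs_fps) (simp add: fps_X_power_nth)
qed

section \<open>The norm estimate\<close>

lemma nth_comp_op_power:
  assumes "0 < m"
  shows "fps_nth (comp_op (fps_X ^ m) f) (n * m) = fps_nth f n"
    and "\<not> m dvd k \<Longrightarrow> fps_nth (comp_op (fps_X ^ m) f) k = 0"
proof -
  have "(\<lambda>i. fps_nth f i * fps_nth ((fps_X ^ m) ^ i) (n * m))
      = (\<lambda>i. if i = n then fps_nth f i else 0)"
    using assms by (auto simp: fun_eq_iff nth_fps_X_power_power)
  then show "fps_nth (comp_op (fps_X ^ m) f) (n * m) = fps_nth f n"
    using sums_unique[OF sums_single[of n "fps_nth f"]] by (simp add: comp_op_def)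
  assume "\<not> m dvd k"
  then have "(\<lambda>i. fps_nth f i * fps_nth ((fps_X ^ m) ^ i) k) = (\<lambda>i. 0)"
    by (auto simp: fun_eq_iff nth_fps_X_power_power)
  then show "fps_nth (comp_op (fps_X ^ m) f) k = 0"
    by (simp add: comp_op_def)
qed

text \<open>
  For \<open>m > 0\<close> the norm series of \<open>f \<circ> z\<^sup>m\<close> lives on the multiples of \<open>m\<close>; reindexed by
  \<open>n \<mapsto> nm\<close> it has the terms \<open>|f\<^sub>n|\<^sup>p \<beta>(nm)\<^sup>p\<close>, each at most \<open>S\<^sup>p\<close> times the
  corresponding term for \<open>f\<close>.
\<close>

lemma comp_op_power_bound_pos:
  assumes p: "1 \<le> p" and \<beta>: "\<And>n. 0 < \<beta> n" and m: "0 < m" and S: "0 \<le> S"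
    and bound: "\<And>n. \<beta> (n * m) \<le> S * \<beta> n"
    and f: "f \<in> lp_space p \<beta>"
  shows "comp_op (fps_X ^ m) f \<in> lp_space p \<beta>"
    and "lp_norm p \<beta> (comp_op (fps_X ^ m) f) \<le> S * lp_norm p \<beta> f"
proof -
  define g where "g = comp_op (fps_X ^ m) f"
  let ?F = "\<lambda>n. cmod (fps_nth f n) powr p * \<beta> n powr p"
  let ?G = "\<lambda>k. cmod (fps_nth g k) powr p * \<beta> k powr p"
  have F: "summable ?F" using f by (simp add: lp_space_def)
  have le: "?G (n * m) \<le> S powr p * ?F n" for n
  proof -
    have "\<beta> (n * m) powr p \<le> (S * \<beta> n) powr p"
      using bound[of n] \<beta>[of "n * m"] p by (intro powr_mono2) auto
    also have "\<dots> = S powr p * \<beta> n powr p"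
      using S \<beta>[of n] by (simp add: powr_mult)
    finally have "cmod (fps_nth f n) powr p * \<beta> (n * m) powr p
        \<le> cmod (fps_nth f n) powr p * (S powr p * \<beta> n powr p)"
      by (rule mult_left_mono) simp
    then show ?thesis
      unfolding g_def nth_comp_op_power(1)[OF m] by (simp only: mult_ac)
  qed
  have Gm: "summable (\<lambda>n. ?G (n * m))"
    by (rule summable_comparison_test'[OF summable_mult[OF F, of "S powr p"], of 0])
      (use le in simp)
  have "strict_mono (\<lambda>n. n * m)" using m by (auto simp: strict_mono_def)
  moreover have "?G k = 0" if "k \<notin> range (\<lambda>n. n * m)" for k
  proof -
    have "\<not> m dvd k" using that by (auto simp: dvd_def mult.commute)
    then show ?thesis by (simp add: g_def nth_comp_op_power(2)[OF m])
  qed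
  ultimately have G: "?G sums (\<Sum>n. ?G (n * m))"
    using sums_mono_reindex[of "\<lambda>n. n * m" ?G] summable_sums[OF Gm] by blast
  show "comp_op (fps_X ^ m) f \<in> lp_space p \<beta>"
    using G by (simp add: lp_space_def sums_iff g_def)
  have "(\<Sum>n. ?G (n * m)) \<le> (\<Sum>n. S powr p * ?F n)"
    by (intro suminf_le le Gm summable_mult F)
  also have "\<dots> = S powr p * suminf ?F" by (rule suminf_mult[OF F])
  finally show "lp_norm p \<beta> (comp_op (fps_X ^ m) f) \<le> S * lp_norm p \<beta> f"
    using lp_norm_mono_sums[OF p S G summable_sums[OF F]] by (simp add: g_def)
qed

text \<open>
  Composition with the constant \<open>1\<close> is the functional \<open>f \<mapsto> \<Sum>f\<^sub>n\<close>.  When \<open>1 / \<beta>\<close> is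
  bounded, \<open>\<ell>\<^sup>1(\<beta>)\<close> embeds into \<open>\<ell>\<^sup>1\<close>, so this series converges absolutely and is at most
  \<open>\<Sum>|f\<^sub>n| \<le> S \<Sum>|f\<^sub>n| \<beta>(n)\<close>.
\<close>

lemma comp_op_one_bound:
  assumes \<beta>: "\<And>n. 0 < \<beta> n" and \<beta>0: "\<beta> 0 = 1" and S: "0 \<le> S"
    and bound: "\<And>n. 1 \<le> S * \<beta> n"
    and f: "f \<in> lp_space 1 \<beta>"
  shows "composable f 1"
    and "comp_op 1 f \<in> lp_space 1 \<beta>"
    and "lp_norm 1 \<beta> (comp_op 1 f) \<le> S * lp_norm 1 \<beta> f"
proof -
  let ?F = "\<lambda>n. cmod (fps_nth f n) powr 1 * \<beta> n powr 1"
  have F: "summable ?F" using f by (simp add: lp_space_def)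
  have le: "cmod (fps_nth f n) \<le> S * ?F n" for n
    using mult_left_mono[OF bound[of n], of "cmod (fps_nth f n)"] \<beta>[of n]
    by (simp add: mult_ac)
  have N: "summable (\<lambda>n. cmod (fps_nth f n))"
    by (rule summable_comparison_test'[OF summable_mult[OF F, of S], of 0])
      (use le in simp)
  have sf: "summable (fps_nth f)" by (rule summable_norm_cancel[OF N])
  show "composable f 1"
    using sf by (auto simp: composable_def)
  have g: "comp_op 1 f = fps_const (suminf (fps_nth f)) * fps_X ^ 0"
    by (simp add: comp_op_def fps_eq_iff)
  show "comp_op 1 f \<in> lp_space 1 \<beta>"
    unfolding g by (rule lp_norm_monomial(1)) (use \<beta> in auto)
  have "lp_norm 1 \<beta> (comp_op 1 f) = cmod (suminf (fps_nth f)) * \<beta> 0"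
    unfolding g by (rule lp_norm_monomial(2)) (use \<beta> in auto)
  also have "\<dots> \<le> (\<Sum>n. cmod (fps_nth f n))"
    using summable_norm[OF N] by (simp add: \<beta>0)
  also have "\<dots> \<le> (\<Sum>n. S * ?F n)"
    by (intro suminf_le le N summable_mult F)
  also have "\<dots> = S * suminf ?F" by (rule suminf_mult[OF F])
  also have "\<dots> = S * lp_norm 1 \<beta> f"
    using suminf_nonneg[OF F] by (simp add: lp_norm_def)
  finally show "lp_norm 1 \<beta> (comp_op 1 f) \<le> S * lp_norm 1 \<beta> f" .
qed

lemma comp_op_power_bound:
  assumes "1 \<le> p" and "\<And>n. 0 < \<beta> n" and "\<beta> 0 = 1" and "m \<noteq> 0 \<or> p = 1" and "0 \<le> S"
    and "\<And>n. \<beta> (n * m) \<le> S * \<beta> n"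
    and "f \<in> lp_space p \<beta>"
  shows "composable f (fps_X ^ m)"
    and "comp_op (fps_X ^ m) f \<in> lp_space p \<beta>"
    and "lp_norm p \<beta> (comp_op (fps_X ^ m) f) \<le> S * lp_norm p \<beta> f"
proof -
  have "composable f (fps_X ^ m) \<and> comp_op (fps_X ^ m) f \<in> lp_space p \<beta> \<and>
    lp_norm p \<beta> (comp_op (fps_X ^ m) f) \<le> S * lp_norm p \<beta> f"
  proof (cases "m = 0")
    case True
    then show ?thesis
      using assms comp_op_one_bound[of \<beta> S f] by simp
  next
    case False
    then show ?thesis
      using assms comp_op_power_bound_pos[of p \<beta> m S f] composable_if_nth_0[of "fps_X ^ m"]
      by (simp add: fps_X_power_nth)
  qed
  then show "composable f (fps_X ^ m)" "comp_op (fps_X ^ m) f \<in> lp_space p \<beta>"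
    "lp_norm p \<beta> (comp_op (fps_X ^ m) f) \<le> S * lp_norm p \<beta> f" by auto
qed

section \<open>Boundedness and operator norm\<close>

theorem theorem2p1:
  fixes p :: real and \<beta> :: "nat \<Rightarrow> real" and m :: nat
  assumes "1 \<le> p"
    and "\<And>n. 0 < \<beta> n"
    and "\<beta> 0 = 1"
    and "m \<noteq> 0 \<or> p = 1"
  shows "(comp_op_bounded p \<beta> (fps_X ^ m) \<longleftrightarrow> bdd_above (range (\<lambda>n. \<beta> (n * m) / \<beta> n))) \<and>
    (comp_op_bounded p \<beta> (fps_X ^ m) \<longrightarrow>
       op_norm p \<beta> (comp_op (fps_X ^ m)) = (SUP n. \<beta> (n * m) / \<beta> n))"
proof -
  let ?T = "comp_op (fps_X ^ m)"
  define r where "r = (\<lambda>n. \<beta> (n * m) / \<beta> n)"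
  define S where "S = (SUP n. r n)"
  define e where "e = (\<lambda>n. fps_const (complex_of_real (1 / \<beta> n)) * fps_X ^ n)"
  have e: "e n \<in> lp_space p \<beta>" "lp_norm p \<beta> (e n) = 1" "lp_norm p \<beta> (?T (e n)) = r n" for n
    using assms(1) assms(2)[of n] assms(2)[of "n * m"]
    by (simp_all add: e_def r_def comp_op_monomial lp_norm_monomial norm_divide
        del: of_real_divide)
  have "bdd_above (range r)" if C: "comp_op_bounded p \<beta> (fps_X ^ m)"
  proof -
    obtain K where K: "\<And>f. f \<in> lp_space p \<beta> \<Longrightarrow> lp_norm p \<beta> (?T f) \<le> K * lp_norm p \<beta> f"
      using C unfolding comp_op_bounded_def bounded_linear_op_def by blast
    have "r n \<le> K" for n
      using K[OF e(1)[of n]] by (simp add: e)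
    then show ?thesis by (rule bdd_above.I2)
  qed
  moreover have "comp_op_bounded p \<beta> (fps_X ^ m) \<and> op_norm p \<beta> ?T = S"
    if bdd: "bdd_above (range r)"
  proof
    have rS: "r n \<le> S" for n
      unfolding S_def by (rule cSUP_upper[OF _ bdd]) simp
    (* the ratio at index 0 is 1 *)
    have S0: "0 \<le> S"
      using rS[of 0] assms(3) by (simp add: r_def)
    have bound: "\<beta> (n * m) \<le> S * \<beta> n" for n
      using rS[of n] assms(2)[of n] by (simp add: r_def field_simps)
    note T = comp_op_power_bound[OF assms S0 bound]
    show "comp_op_bounded p \<beta> (fps_X ^ m)"
      by (rule comp_op_boundedI[OF T])
    let ?B = "{f \<in> lp_space p \<beta>. lp_norm p \<beta> f \<le> 1}"
    have TB: "lp_norm p \<beta> (?T f) \<le> S" if "f \<in> ?B" for f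
      using T(3)[of f] that mult_left_mono[of "lp_norm p \<beta> f" 1 S] S0 by auto
    have eB: "e n \<in> ?B" for n by (simp add: e)
    show "op_norm p \<beta> ?T = S"
    proof (rule antisym)
      show "op_norm p \<beta> ?T \<le> S"
        unfolding op_norm_def using eB TB by (intro cSUP_least) auto
      have "bdd_above ((\<lambda>f. lp_norm p \<beta> (?T f)) ` ?B)"
        using TB by (rule bdd_above.I2)
      then have "r n \<le> op_norm p \<beta> ?T" for n
        unfolding op_norm_def e(3)[symmetric] using eB[of n] by (rule cSUP_upper2) simp
      then show "S \<le> op_norm p \<beta> ?T"
        unfolding S_def by (intro cSUP_least) auto
    qed
  qed
  ultimately show ?thesis
    by (auto simp: r_def S_def)
qed

end
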